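(* Let $a,b>0$ be real parameters, let $k\in\mathbb{Z}$, let $x>0$ if $k\ge 1$, and $x>|k|+1$ if $k\le 0$, and let ${\rm Re}(s)>0$, $s\ne 1$. Then $$\int_{0}^{\ln (ab)}\xi_k(s,x+w;a,b)\,dw=\frac{1}{s-1}\sum_{m=0}^{\infty}\frac{1}{(m+1)^k}\sum_{j=0}^{m+1}\binom{m+1}{j}(-1)^{j+1}\frac{1}{\bigl(x+j\ln a+(j+1)\ln b\bigr)^{s-1}} .$$
   Context: For $k\in\mathbb{Z}$, ${\rm Li}_k(z)=\sum_{m=1}^{\infty} z^m/m^k$. The generalized Arakawa-Kaneko zeta function with parameters $a,b$ is given by $$\xi_k(s,x;a,b)=\frac{1}{\Gamma(s)}\int_{0}^{\infty}\frac{{\rm Li}_k(1-(ab)^{-t})}{b^t-a^{-t}}\,e^{-xt}\,t^{s-1}\,dt;$$ it is defined for ${\rm Re}(s)>0$ and $x>0$ if $k\ge 1$, and for ${\rm Re}(s)>0$ and $x>|k|+1$ if $k\le 0$.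
   Formalization: The sign (-1)^{j+1} is corrected to (-1)^j (at a=e, b=1, k=0, x=s=2 the integral is 1/2, not -1/2); ab>1 is assumed, and so is convergence of the integral defining ξ_k: x+ln b>0 if k≥1, x+ln b>(|k|+1)ln(ab) if k≤0, since otherwise ξ_k is undefined. *)

theory Defs
  imports "HOL-Analysis.Analysis"
begin

text \<open>The polylogarithm is the series itself; it is a junk value where the series diverges, so it is
only meaningful on the open unit disc (and on parts of its boundary when \<open>k \<ge> 1\<close>).\<close>

definition polylog :: "int \<Rightarrow> complex \<Rightarrow> complex" where
  "polylog k z = (\<Sum>m. z ^ Suc m / of_nat (Suc m) powi k)"

text \<open>In the integrand below, \<open>0 < 1 - (a b)\<^sup>-\<^sup>t < 1\<close> for all \<open>t > 0\<close> exactly when \<open>a b > 1\<close>.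
For \<open>a b = 1\<close> the denominator vanishes identically, and for \<open>0 < a b < 1\<close> the polylogarithm series
diverges for all large \<open>t\<close>.\<close>

definition xi_integrand ::
  "int \<Rightarrow> complex \<Rightarrow> real \<Rightarrow> real \<Rightarrow> real \<Rightarrow> real \<Rightarrow> complex" where
  "xi_integrand k s x a b t =
     polylog k (of_real (1 - (a * b) powr (- t))) / of_real (b powr t - a powr (- t))
       * of_real (exp (- x * t)) * of_real t powr (s - 1)"

definition arakawa_kaneko_xi ::
  "int \<Rightarrow> complex \<Rightarrow> real \<Rightarrow> real \<Rightarrow> real \<Rightarrow> complex" where
  "arakawa_kaneko_xi k s x a b =
     1 / Gamma s * (LINT t:{0<..}|lborel. xi_integrand k s x a b t)"

text \<open>For \<open>a b > 1\<close> and \<open>Re s > 0\<close>, the defining integral converges exactly on the following set of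
\<open>x\<close>: as \<open>t \<rightarrow> \<infinity>\<close>, \<open>b\<^sup>t - a\<^sup>-\<^sup>t\<close> is asymptotic to \<open>exp (t ln b)\<close>, while the polylogarithm factor is of
polynomial growth if \<open>k \<ge> 1\<close>, and asymptotic to a constant times \<open>exp ((\<bar>k\<bar> + 1) t ln (a b))\<close>
if \<open>k \<le> 0\<close>. In the classical case \<open>a = e\<close>, \<open>b = 1\<close>, these are the conditions \<open>x > 0\<close> and
\<open>x > \<bar>k\<bar> + 1\<close>; for other \<open>a, b\<close> those two conditions do not suffice.\<close>

definition xi_converges :: "int \<Rightarrow> real \<Rightarrow> real \<Rightarrow> real \<Rightarrow> bool" where
  "xi_converges k x a b \<longleftrightarrow>
     (if k \<ge> 1 then x + ln b > 0
      else x + ln b > (real_of_int \<bar>k\<bar> + 1) * ln (a * b))"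

text \<open>Pitfall on signs: because \<open>b\<^sup>t - a\<^sup>-\<^sup>t = b\<^sup>t (1 - (a b)\<^sup>-\<^sup>t)\<close>, integrating \<open>arakawa_kaneko_xi k s (x + w) a b\<close>
over \<open>w\<close> from \<open>0\<close> to \<open>ln (a b)\<close> gives a binomial sum with coefficients \<open>(-1)\<^sup>j\<close>. The source prints
\<open>(-1)\<^sup>j\<^sup>+\<^sup>1\<close>, which fails for instance at \<open>a = e\<close>, \<open>b = 1\<close>, \<open>k = 0\<close>, \<open>x = s = 2\<close>, where the integral is \<open>1/2\<close>
and the printed right-hand side is \<open>-1/2\<close>.\<close>

end

theory Submission
  imports Defs
begin

text \<open>Put \<open>c = ln (a b)\<close>, \<open>p = x + ln b\<close> and \<open>u = 1 - exp (- c t)\<close>, so that \<open>b\<^sup>t - a\<^sup>-\<^sup>t = b\<^sup>t u\<close> and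
the integrand of \<open>\<xi>\<^sub>k(s, x + w; a, b)\<close> is \<open>(\<Sum>m. u\<^sup>m / (m + 1)\<^sup>k) exp (- (p + w) t) t\<^sup>s\<^sup>-\<^sup>1\<close>. Its partial
sums are dominated uniformly in \<open>w \<ge> 0\<close> and expand by the binomial theorem into Gamma integrals, so
\<open>\<xi>\<^sub>k(s, x + w; a, b)\<close> is a boundedly convergent series of combinations of \<open>(p + w + i c)\<^sup>-\<^sup>s\<close>. Integrating
over \<open>w\<close> only afterwards keeps the exponent of \<open>t\<close> at \<open>s - 1\<close>, so that the case \<open>0 < Re s \<le> 1\<close> needs
no analytic continuation; Pascal's rule then turns \<open>C(m, i)\<close> into \<open>C(m + 1, j)\<close>.\<close>

section \<open>Gamma integrals of exponentials\<close>

text \<open>Euler's integral for \<open>Gamma s\<close> after the substitution of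
  \<open>p * t\<close> for \<open>t\<close>. The indicator extends the integrand by zero to the
  whole line, where the affine change of variables is available.\<close>

lemma has_bochner_integral_powr_exp:
  fixes s :: complex and p :: real
  assumes s: "Re s > 0" and p: "p > 0"
  shows "has_bochner_integral lborel
    (\<lambda>t. indicator {0<..} t *\<^sub>R (of_real (exp (- p * t)) * of_real t powr (s - 1)))
    (Gamma s * of_real p powr (- s))"
proof -
  define f :: "real \<Rightarrow> complex" where
    "f t = indicator {0<..} t *\<^sub>R (of_real t powr (s - 1) / of_real (exp t))" for t
  \<comment> \<open>Only the real logarithm and the complex exponential occur in this form, so
    measurability is automatic.\<close>
  have f_eq: "f = (\<lambda>t. indicator {0<..} t *\<^sub>R (exp ((s - 1) * of_real (ln t)) / of_real (exp t)))"
    by (auto simp: fun_eq_iff f_def powr_def Ln_of_real indicator_def)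
  have f_meas: "f \<in> borel_measurable lborel"
    unfolding f_eq by measurable
  have "integrable lebesgue f"
    using absolutely_integrable_Gamma_integral'[OF s] unfolding set_integrable_def f_def .
  then have f_int: "integrable lborel f"
    using integrable_completion[OF f_meas] by simp
  then have "set_integrable lborel {0<..} (\<lambda>t. complex_of_real t powr (s - 1) / of_real (exp t))"
    unfolding set_integrable_def f_def .
  from set_borel_integral_eq_integral(2)[OF this] integral_unique[OF Gamma_integral_complex'[OF s]]
  have "integral\<^sup>L lborel f = Gamma s"
    unfolding set_lebesgue_integral_def f_def by simp
  with f_int have "has_bochner_integral lborel f (Gamma s)"
    by (simp add: has_bochner_integral_iff)
  then have "has_bochner_integral lborel (\<lambda>t. f (0 + p * t)) (Gamma s /\<^sub>R \<bar>p\<bar>)"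
    using p by (subst (asm) lborel_has_bochner_integral_real_affine_iff[where t = 0 and c = p]) auto
  \<comment> \<open>This factor cancels the \<open>p powr (s - 1)\<close> that rescaling produces in
    the integrand; together with the Jacobian \<open>1 / p\<close> it leaves
    \<open>p powr (- s)\<close>.\<close>
  then have "has_bochner_integral lborel (\<lambda>t. of_real p powr (1 - s) * f (0 + p * t))
      (of_real p powr (1 - s) * (Gamma s /\<^sub>R \<bar>p\<bar>))"
    by (intro has_bochner_integral_mult_right)
  moreover have "of_real p powr (1 - s) * f (0 + p * t) =
      indicator {0<..} t *\<^sub>R (of_real (exp (- p * t)) * of_real t powr (s - 1))" for t
  proof (cases "t > 0")
    case True
    have "of_real p powr (1 - s) * complex_of_real p powr (s - 1) = 1"
      using p by (simp flip: powr_add)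
    then show ?thesis
      using p True
      by (simp add: f_def powr_times_real exp_minus field_simps)
  next
    case False
    then show ?thesis using p by (auto simp: f_def indicator_def zero_less_mult_iff)
  qed
  moreover have "of_real p powr (1 - s) * (Gamma s /\<^sub>R \<bar>p\<bar>) = Gamma s * of_real p powr (- s)"
    using p by (simp add: powr_diff powr_minus scaleR_conv_of_real field_simps)
  ultimately show ?thesis by simp
qed

text \<open>The binomial theorem expands the power into exponentials, the \<open>i\<close>-th of
  which moves \<open>p\<close> to \<open>p + i * c\<close>; each term is then a Gamma
  integral.\<close>

lemma has_bochner_integral_one_minus_exp_power:
  fixes s :: complex and p c :: real
  assumes s: "Re s > 0" and p: "p > 0" and c: "c \<ge> 0"
  shows "has_bochner_integral lborel
    (\<lambda>t. indicator {0<..} t *\<^sub>R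
       (of_real ((1 - exp (- c * t)) ^ m) * (of_real (exp (- p * t)) * of_real t powr (s - 1))))
    (Gamma s * (\<Sum>i\<le>m. of_nat (m choose i) * (-1) ^ i * of_real (p + real i * c) powr (- s)))"
proof -
  have "(1 - exp (- c * t)) ^ m * exp (- p * t) =
      (\<Sum>i\<le>m. real (m choose i) * (-1) ^ i * exp (- (p + real i * c) * t))" for t
  proof -
    have "(1 - exp (- c * t)) ^ m = (\<Sum>i\<le>m. real (m choose i) * (- exp (- c * t)) ^ i)"
      using binomial_ring[of "- exp (- c * t)" 1 m] by simp
    then have "(1 - exp (- c * t)) ^ m * exp (- p * t) =
        (\<Sum>i\<le>m. real (m choose i) * (- exp (- c * t)) ^ i * exp (- p * t))"
      by (simp add: sum_distrib_right)
    also have "\<dots> = (\<Sum>i\<le>m. real (m choose i) * (-1) ^ i * exp (- (p + real i * c) * t))"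
    proof (rule sum.cong[OF refl])
      fix i
      have "exp (- (p + real i * c) * t) = exp (- c * t) ^ i * exp (- p * t)"
        by (simp add: exp_of_nat_mult[symmetric] exp_add[symmetric] algebra_simps)
      then show "real (m choose i) * (- exp (- c * t)) ^ i * exp (- p * t) =
          real (m choose i) * (-1) ^ i * exp (- (p + real i * c) * t)"
        by (simp add: power_minus[of "exp (- (c * t))"])
    qed
    finally show ?thesis .
  qed
  then have "of_real ((1 - exp (- c * t)) ^ m) * (of_real (exp (- p * t)) * of_real t powr (s - 1)) =
      (\<Sum>i\<le>m. complex_of_real (real (m choose i) * (-1) ^ i) *
        (of_real (exp (- (p + real i * c) * t)) * of_real t powr (s - 1)))" for t
    by (simp only: mult.assoc[symmetric] of_real_mult[symmetric] of_real_sum[symmetric]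
        sum_distrib_right[symmetric])
  then have eq: "indicator {0<..} t *\<^sub>R
       (of_real ((1 - exp (- c * t)) ^ m) * (of_real (exp (- p * t)) * of_real t powr (s - 1))) =
      (\<Sum>i\<le>m. complex_of_real (real (m choose i) * (-1) ^ i) * (indicator {0<..} t *\<^sub>R
        (of_real (exp (- (p + real i * c) * t)) * of_real t powr (s - 1))))" for t :: real
    by (simp only: scaleR_sum_right mult_scaleR_right)
  have "has_bochner_integral lborel
      (\<lambda>t. \<Sum>i\<le>m. complex_of_real (real (m choose i) * (-1) ^ i) * (indicator {0<..} t *\<^sub>R
        (of_real (exp (- (p + real i * c) * t)) * of_real t powr (s - 1))))
      (\<Sum>i\<le>m. complex_of_real (real (m choose i) * (-1) ^ i) *
        (Gamma s * of_real (p + real i * c) powr (- s)))"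
    using p c
    by (intro has_bochner_integral_sum has_bochner_integral_mult_right
        has_bochner_integral_powr_exp s) (auto intro: add_pos_nonneg)
  then show ?thesis
    unfolding eq by (simp add: sum_distrib_left mult_ac)
qed

section \<open>Bounds for partial sums of the polylogarithm, uniform in the length\<close>

text \<open>Summation by parts: multiplying by \<open>1 - u\<close> replaces a power of
  \<open>Suc m\<close> by its backward difference, which is of one degree less by a discrete mean
  value estimate. Each induction step thus costs one factor \<open>1 / (1 - u)\<close>.\<close>

lemma sum_power_mult_le:
  fixes u :: real
  assumes u: "0 \<le> u" "u < 1"
  shows "(\<Sum>m<M. real (Suc m) ^ n * u ^ m) \<le> fact n / (1 - u) ^ Suc n"
proof (induction n)
  case 0
  have "(1 - u) * (\<Sum>m<M. u ^ m) \<le> 1"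
    using u by (simp flip: one_diff_power_eq)
  then show ?case using u by (simp add: field_simps)
next
  case (Suc n)
  have abel: "(1 - u) * (\<Sum>m<M. real (Suc m) ^ Suc n * u ^ m) =
      (\<Sum>m<M. (real (Suc m) ^ Suc n - real m ^ Suc n) * u ^ m) - real M ^ Suc n * u ^ M"
    by (induction M) (simp_all add: algebra_simps)
  have diff: "real (Suc m) ^ Suc j - real m ^ Suc j \<le> real (Suc j) * real (Suc m) ^ j" for m j
  proof (induction j)
    case (Suc j)
    have "real (Suc m) ^ Suc (Suc j) - real m ^ Suc (Suc j) =
        real m * (real (Suc m) ^ Suc j - real m ^ Suc j) + real (Suc m) ^ Suc j"
      by (simp add: algebra_simps)
    also have "\<dots> \<le> real m * (real (Suc j) * real (Suc m) ^ j) + real (Suc m) ^ Suc j"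
      using Suc by (intro add_right_mono mult_left_mono) auto
    also have "\<dots> \<le> real (Suc m) * (real (Suc j) * real (Suc m) ^ j) + real (Suc m) ^ Suc j"
      by (intro add_right_mono mult_right_mono) auto
    also have "\<dots> = real (Suc (Suc j)) * real (Suc m) ^ Suc j"
      by (simp add: algebra_simps)
    finally show ?case .
  qed simp
  have "(1 - u) * (\<Sum>m<M. real (Suc m) ^ Suc n * u ^ m) \<le>
      (\<Sum>m<M. (real (Suc m) ^ Suc n - real m ^ Suc n) * u ^ m)"
    unfolding abel using u by simp
  also have "\<dots> \<le> (\<Sum>m<M. real (Suc n) * real (Suc m) ^ n * u ^ m)"
    using u by (intro sum_mono mult_right_mono diff) auto
  also have "\<dots> = real (Suc n) * (\<Sum>m<M. real (Suc m) ^ n * u ^ m)"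
    by (simp add: sum_distrib_left mult.assoc)
  also have "\<dots> \<le> real (Suc n) * (fact n / (1 - u) ^ Suc n)"
    using Suc by (intro mult_left_mono) auto
  finally have "(\<Sum>m<M. real (Suc m) ^ Suc n * u ^ m) \<le>
      real (Suc n) * (fact n / (1 - u) ^ Suc n) / (1 - u)"
    using u by (subst pos_le_divide_eq) (simp_all add: mult.commute)
  then show ?case by (simp add: mult.commute)
qed

lemma sum_power_divide_le:
  fixes u :: real
  assumes u: "0 \<le> u" "u < 1"
  shows "(\<Sum>m<M. u ^ Suc m / real (Suc m)) \<le> - ln (1 - u)"
proof -
  have "(\<lambda>n. - (u ^ n) / real n) sums ln (1 - u)"
    using ln_series'[of "- u"] u by (simp add: power_minus' power_mult_distrib[symmetric])
  then have "(\<lambda>n. u ^ n / real n) sums - ln (1 - u)"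
    using sums_minus by fastforce
  \<comment> \<open>The index shift costs nothing: the term at 0 is a division by zero, hence
    0.\<close>
  then have "(\<lambda>m. u ^ Suc m / real (Suc m)) sums - ln (1 - u)"
    by (subst sums_Suc_iff) simp
  then show ?thesis
    using u sum_le_suminf[of "\<lambda>m. u ^ Suc m / real (Suc m)" "{..<M}"]
    by (auto simp: sums_iff)
qed

text \<open>One bound for both signs of \<open>k\<close>. With \<open>u = 1 - exp (- y)\<close>, the
  logarithmic growth at \<open>u = 1\<close> for \<open>k \<ge> 1\<close> becomes the factor
  \<open>1 + y\<close>, and the pole of order \<open>\<bar>k\<bar> + 1\<close> for
  \<open>k \<le> 0\<close> becomes the exponential. The exponent of \<open>u\<close> is
  \<open>m\<close>, not \<open>m + 1\<close>, since the polylogarithm will be divided by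
  \<open>u\<close>.\<close>

lemma sum_one_minus_exp_power_le:
  fixes y :: real and k :: int
  assumes y: "y > 0"
  shows "(\<Sum>m<M. (1 - exp (- y)) ^ m / real (Suc m) powi k) \<le>
    fact (nat (- k)) * (1 + y) * exp ((if k \<ge> 1 then 0 else real_of_int \<bar>k\<bar> + 1) * y)"
proof -
  define u where "u = 1 - exp (- y)"
  have u: "0 < u" "u < 1" using y by (auto simp: u_def)
  show ?thesis
  proof (cases "k \<ge> 1")
    case True
    \<comment> \<open>The extra factor \<open>u\<close> gives access to the logarithmic series, by
      comparison with the case \<open>k = 1\<close>.\<close>
    have "u * (\<Sum>m<M. u ^ m / real (Suc m) powi k) = (\<Sum>m<M. u ^ Suc m / real (Suc m) powi k)"
      by (simp add: sum_distrib_left)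
    also have "\<dots> \<le> (\<Sum>m<M. u ^ Suc m / real (Suc m))"
    proof (rule sum_mono)
      fix m
      have "real (Suc m) powi 1 \<le> real (Suc m) powi k"
        using True by (intro power_int_increasing) auto
      then show "u ^ Suc m / real (Suc m) powi k \<le> u ^ Suc m / real (Suc m)"
        using u by (intro divide_left_mono) auto
    qed
    also have "\<dots> \<le> - ln (1 - u)" using u by (intro sum_power_divide_le) auto
    also have "\<dots> = y" by (simp add: u_def)
    \<comment> \<open>Equivalent to \<open>1 + y \<le> exp y\<close>; it supplies the factor
      \<open>u\<close> to be cancelled.\<close>
    also have "y \<le> u * (1 + y)"
      using exp_ge_add_one_self[of y] by (simp add: u_def exp_minus field_simps)
    finally show ?thesis using u True by (simp add: u_def)
  next
    case False
    define n where "n = nat (- k)"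
    have k: "k = - int n" using False by (simp add: n_def)
    have "(\<Sum>m<M. u ^ m / real (Suc m) powi k) = (\<Sum>m<M. real (Suc m) ^ n * u ^ m)"
      by (simp add: k power_int_minus field_simps del: of_nat_Suc)
    also have "\<dots> \<le> fact n / (1 - u) ^ Suc n"
      using u by (intro sum_power_mult_le) auto
    also have "\<dots> = fact n * 1 * exp ((real n + 1) * y)"
      by (simp add: u_def exp_of_nat_mult[symmetric] exp_minus[symmetric] exp_add[symmetric]
          field_simps flip: power_Suc)
    also have "\<dots> \<le> fact n * (1 + y) * exp ((real n + 1) * y)"
      using y by (intro mult_right_mono mult_left_mono) auto
    finally show ?thesis by (simp add: u_def k)
  qed
qed

section \<open>Pascal's rule for alternating sums\<close>

text \<open>Pascal's rule splits the left side into two sums over row \<open>m\<close>, one of them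
  shifted by one. The differences on the right are what integration over an interval of length
  \<open>c\<close> produces.\<close>

lemma alternating_binomial_sum_Suc:
  fixes G :: "nat \<Rightarrow> 'a::comm_ring_1"
  shows "(\<Sum>j=0..Suc m. of_nat (Suc m choose j) * (-1) ^ j * G j) =
    (\<Sum>i\<le>m. of_nat (m choose i) * (-1) ^ i * (G i - G (Suc i)))"
proof -
  have "(\<Sum>j=0..Suc m. of_nat (Suc m choose j) * (-1) ^ j * G j) =
      G 0 + (\<Sum>i\<le>m. of_nat (Suc m choose Suc i) * (-1) ^ Suc i * G (Suc i))"
    by (simp add: atLeast0AtMost sum.atMost_Suc_shift del: binomial_Suc_Suc sum.atMost_Suc)
  also have "\<dots> = G 0 + (\<Sum>i\<le>m. of_nat (m choose Suc i) * (-1) ^ Suc i * G (Suc i)) -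
      (\<Sum>i\<le>m. of_nat (m choose i) * (-1) ^ i * G (Suc i))"
    by (simp add: algebra_simps sum.distrib sum_subtractf sum_negf)
  also have "G 0 + (\<Sum>i\<le>m. of_nat (m choose Suc i) * (-1) ^ Suc i * G (Suc i)) =
      (\<Sum>i\<le>Suc m. of_nat (m choose i) * (-1) ^ i * G i)"
    by (simp add: sum.atMost_Suc_shift del: sum.atMost_Suc)
  also have "\<dots> = (\<Sum>i\<le>m. of_nat (m choose i) * (-1) ^ i * G i)"
    by (simp add: binomial_eq_0)
  finally show ?thesis
    by (simp add: algebra_simps sum_subtractf)
qed

section \<open>Truncated integrals and passage to the limit under the integral over
  \<open>t\<close>\<close>

text \<open>The truncated zeta function after evaluation of its Gamma integrals. The parameters
  \<open>a\<close>, \<open>b\<close>, \<open>x\<close> enter only through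
  \<open>c = ln (a * b)\<close> and \<open>p = x + ln b\<close>.\<close>

definition xi_partial_sum :: "int \<Rightarrow> complex \<Rightarrow> real \<Rightarrow> nat \<Rightarrow> real \<Rightarrow> complex" where
  "xi_partial_sum k s c M p = (\<Sum>m<M. 1 / of_nat (Suc m) powi k *
     (\<Sum>i\<le>m. of_nat (m choose i) * (-1) ^ i * of_real (p + real i * c) powr (- s)))"

text \<open>The factor \<open>u = 1 - exp (- c * t)\<close> of the denominator is already cancelled
  against one power of \<open>u\<close> in each term, so no quotient remains.\<close>

definition xi_partial_integrand ::
  "int \<Rightarrow> complex \<Rightarrow> real \<Rightarrow> nat \<Rightarrow> real \<Rightarrow> real \<Rightarrow> complex" where
  "xi_partial_integrand k s c M p t = indicator {0<..} t *\<^sub>R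
     (of_real (\<Sum>m<M. (1 - exp (- c * t)) ^ m / real (Suc m) powi k) *
       (of_real (exp (- p * t)) * of_real t powr (s - 1)))"

lemma has_bochner_integral_xi_partial_integrand:
  assumes "Re s > 0" "p > 0" "c \<ge> 0"
  shows "has_bochner_integral lborel (xi_partial_integrand k s c M p)
    (Gamma s * xi_partial_sum k s c M p)"
proof -
  have "has_bochner_integral lborel (\<lambda>t. \<Sum>m<M. 1 / of_nat (Suc m) powi k * (indicator {0<..} t *\<^sub>R
       (of_real ((1 - exp (- c * t)) ^ m) * (of_real (exp (- p * t)) * of_real t powr (s - 1)))))
     (\<Sum>m<M. 1 / of_nat (Suc m) powi k * (Gamma s *
       (\<Sum>i\<le>m. of_nat (m choose i) * (-1) ^ i * of_real (p + real i * c) powr (- s))))"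
    by (intro has_bochner_integral_sum has_bochner_integral_mult_right
        has_bochner_integral_one_minus_exp_power assms)
  moreover have "(\<lambda>t. \<Sum>m<M. 1 / of_nat (Suc m) powi k * (indicator {0<..} t *\<^sub>R
       (of_real ((1 - exp (- c * t)) ^ m) * (of_real (exp (- p * t)) * of_real t powr (s - 1)))))
      = xi_partial_integrand k s c M p"
    by (simp add: fun_eq_iff xi_partial_integrand_def of_real_power_int
        sum_distrib_right sum_distrib_left scaleR_sum_right divide_simps mult_ac
        del: of_nat_Suc)
  ultimately show ?thesis
    by (simp add: xi_partial_sum_def sum_distrib_left mult_ac del: of_nat_Suc)
qed

text \<open>The majorant depends neither on \<open>M\<close> nor on \<open>p \<ge> q\<close>: the
  former permits the limit in \<open>M\<close>, the latter yields a bound uniform in the shift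
  \<open>w\<close>.\<close>

lemma xi_partial_integrand_dominated:
  fixes s :: complex and c q :: real and k :: int
  assumes s: "Re s > 0" and c: "c > 0"
    and q: "q > (if k \<ge> 1 then 0 else real_of_int \<bar>k\<bar> + 1) * c"
  obtains K where "integrable lborel K"
    "\<And>M p t. p \<ge> q \<Longrightarrow> norm (xi_partial_integrand k s c M p t) \<le> K t"
proof
  define d where "d = (if k \<ge> 1 then 0 else real_of_int \<bar>k\<bar> + 1)"
  \<comment> \<open>The decay left after absorbing the growth \<open>exp (d * c * t)\<close>; the
    hypothesis on \<open>q\<close> says exactly that it is positive.\<close>
  define r where "r = q - d * c"
  have r: "r > 0" using q by (simp add: r_def d_def)
  define E where "E \<sigma> t = indicator {0<..} t * (exp (- r * t) * t powr (\<sigma> - 1))" for \<sigma> t :: real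
  have E_int: "integrable lborel (E \<sigma>)" if "\<sigma> > 0" for \<sigma>
  proof -
    have "integrable lborel (\<lambda>t. indicator {0<..} t *\<^sub>R
        (complex_of_real (exp (- r * t)) * of_real t powr (of_real \<sigma> - 1)))"
      using has_bochner_integral_powr_exp[of "of_real \<sigma>" r] that r
      by (simp add: has_bochner_integral_iff)
    then have "integrable lborel (\<lambda>t. norm (indicator {0<..} t *\<^sub>R
        (complex_of_real (exp (- r * t)) * of_real t powr (of_real \<sigma> - 1))))"
      by (rule integrable_norm)
    moreover have "norm (indicator {0<..} t *\<^sub>R
        (complex_of_real (exp (- r * t)) * of_real t powr (of_real \<sigma> - 1))) = E \<sigma> t" for t
      by (auto simp: E_def norm_mult norm_powr_real_powr indicator_def)
    ultimately show ?thesis by simp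
  qed
  \<comment> \<open>The two summands come from the factor \<open>1 + c * t\<close>; its linear part
    raises the exponent of \<open>t\<close> by one.\<close>
  define K where "K t = fact (nat (- k)) * (E (Re s) t + c * E (Re s + 1) t)" for t
  show "integrable lborel K"
    unfolding K_def using s
    by (intro integrable_mult_right Bochner_Integration.integrable_add E_int) auto
  show "norm (xi_partial_integrand k s c M p t) \<le> K t" if p: "p \<ge> q" for M p t
  proof (cases "t > 0")
    case t: True
    define S where "S = (\<Sum>m<M. (1 - exp (- c * t)) ^ m / real (Suc m) powi k)"
    have S0: "S \<ge> 0"
      unfolding S_def using t c by (intro sum_nonneg divide_nonneg_nonneg zero_le_power) auto
    have "S \<le> fact (nat (- k)) * (1 + c * t) * exp (d * (c * t))"
      using sum_one_minus_exp_power_le[of "c * t" k M] t c by (simp add: S_def d_def)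
    then have "S * exp (- p * t) \<le>
        fact (nat (- k)) * (1 + c * t) * exp (d * (c * t)) * exp (- q * t)"
      using p t S0 c by (intro mult_mono) auto
    also have "\<dots> = fact (nat (- k)) * (1 + c * t) * exp (- r * t)"
      by (simp add: r_def algebra_simps flip: exp_add)
    finally have "S * exp (- p * t) * t powr (Re s - 1) \<le>
        fact (nat (- k)) * (1 + c * t) * exp (- r * t) * t powr (Re s - 1)"
      by (intro mult_right_mono) auto
    also have "t * t powr (Re s - 1) = t powr (Re s)"
      using t by (simp add: powr_diff)
    then have "fact (nat (- k)) * (1 + c * t) * exp (- r * t) * t powr (Re s - 1) = K t"
      using t by (simp add: K_def E_def algebra_simps)
    finally show ?thesis
      unfolding xi_partial_integrand_def S_def[symmetric]
      using t S0 by (simp add: norm_mult norm_powr_real_powr mult.assoc)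
  qed (simp add: xi_partial_integrand_def K_def E_def)
qed

text \<open>Since \<open>b powr t - a powr (- t)\<close> equals \<open>b powr t * u\<close>, the
  quotient in the integrand loses the factor \<open>u\<close>, and \<open>b powr t\<close> joins the
  exponential to give the rate \<open>x + ln b\<close>.\<close>

lemma xi_partial_integrand_tendsto:
  fixes a b x t :: real and k :: int and s :: complex
  assumes ab: "a > 0" "b > 0" "a * b > 1"
  shows "(\<lambda>M. xi_partial_integrand k s (ln (a * b)) M (x + ln b) t) \<longlonglongrightarrow>
    indicator {0<..} t *\<^sub>R xi_integrand k s x a b t"
proof (cases "t > 0")
  case t: True
  define c where "c = ln (a * b)"
  have c: "c > 0" using ab by (simp add: c_def)
  define u where "u = 1 - exp (- c * t)"
  have u: "0 < u" "u < 1" using c t by (auto simp: u_def)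
  define r where "r m = u ^ m / real (Suc m) powi k" for m
  have r0: "r m \<ge> 0" for m using u by (simp add: r_def)
  \<comment> \<open>Nonnegative terms with bounded partial sums; hence \<open>polylog\<close> is a
    genuine sum here and no junk value.\<close>
  have "summable r"
    using sum_one_minus_exp_power_le[of "c * t" k] c t r0
    by (intro summableI_nonneg_bounded) (auto simp: r_def u_def)
  then have r_sums: "r sums suminf r" by (rule summable_sums)
  then have "(\<lambda>m. complex_of_real (u * r m)) sums of_real (u * suminf r)"
    by (intro sums_of_real sums_mult)
  moreover have "complex_of_real (u * r m) = of_real u ^ Suc m / of_nat (Suc m) powi k" for m
    by (simp add: r_def of_real_power_int del: of_nat_Suc)
  ultimately have polylog: "polylog k (of_real u) = of_real (u * suminf r)"
    unfolding polylog_def by (simp add: sums_iff)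
  have powr_ab: "(a * b) powr (- t) = exp (- c * t)"
    using ab by (simp add: powr_def c_def)
  have "a powr (- t) = b powr t * (a * b) powr (- t)"
    using ab by (simp add: powr_mult powr_minus field_simps)
  then have denom: "b powr t - a powr (- t) = b powr t * u"
    by (simp add: powr_ab u_def algebra_simps)
  have "exp (- x * t) / b powr t = exp (- (x + ln b) * t)"
    using ab by (simp add: powr_def exp_diff[symmetric] algebra_simps)
  moreover have "u * suminf r / (b powr t * u) * exp (- x * t) = suminf r * (exp (- x * t) / b powr t)"
    using u by simp
  ultimately have "u * suminf r / (b powr t * u) * exp (- x * t) =
      suminf r * exp (- (x + ln b) * t)"
    by simp
  then have "xi_integrand k s x a b t =
      of_real (suminf r) * (of_real (exp (- (x + ln b) * t)) * of_real t powr (s - 1))"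
    unfolding xi_integrand_def powr_ab u_def[symmetric] polylog denom
    by (simp only: of_real_mult[symmetric] of_real_divide[symmetric] mult.assoc[symmetric])
  moreover have "(\<lambda>M. \<Sum>m<M. r m) \<longlonglongrightarrow> suminf r"
    using r_sums by (simp add: sums_def)
  then have "(\<lambda>M. of_real (\<Sum>m<M. r m) * (of_real (exp (- (x + ln b) * t)) * of_real t powr (s - 1)))
      \<longlonglongrightarrow> of_real (suminf r) * (of_real (exp (- (x + ln b) * t)) * of_real t powr (s - 1))"
    by (intro tendsto_intros)
  ultimately show ?thesis
    using t by (simp add: xi_partial_integrand_def r_def u_def c_def)
qed (simp add: xi_partial_integrand_def)

lemma xi_converges_bound:
  assumes "xi_converges k x a b" "a * b > 1"
  shows "x + ln b > (if k \<ge> 1 then 0 else real_of_int \<bar>k\<bar> + 1) * ln (a * b)" "x + ln b > 0"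
proof -
  show 1: "x + ln b > (if k \<ge> 1 then 0 else real_of_int \<bar>k\<bar> + 1) * ln (a * b)"
    using assms by (auto simp: xi_converges_def split: if_splits)
  have "(if k \<ge> 1 then 0 else real_of_int \<bar>k\<bar> + 1) * ln (a * b) \<ge> 0"
    using assms by auto
  with 1 show "x + ln b > 0" by linarith
qed

text \<open>Dominated convergence in \<open>t\<close>, followed by cancellation of
  \<open>Gamma s\<close>.\<close>

lemma xi_partial_sum_tendsto:
  fixes a b x :: real and k :: int and s :: complex
  assumes ab: "a > 0" "b > 0" "a * b > 1"
    and conv: "xi_converges k x a b" and s: "Re s > 0"
  shows "(\<lambda>M. xi_partial_sum k s (ln (a * b)) M (x + ln b)) \<longlonglongrightarrow> arakawa_kaneko_xi k s x a b"
proof -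
  define c where "c = ln (a * b)"
  have c: "c > 0" using ab by (simp add: c_def)
  note q = xi_converges_bound[OF conv ab(3), folded c_def]
  \<comment> \<open>\<open>Gamma\<close> takes the value 0 only by convention at its poles, which
    \<open>Re s > 0\<close> excludes.\<close>
  have Gamma: "Gamma s \<noteq> 0"
    using s by (auto simp: Gamma_eq_zero_iff elim!: nonpos_Ints_cases)
  note int = has_bochner_integral_xi_partial_integrand[OF s q(2) less_imp_le[OF c], of k]
  have meas: "xi_partial_integrand k s c M (x + ln b) \<in> borel_measurable lborel" for M
    using int[of M] unfolding has_bochner_integral_iff by (blast intro: borel_measurable_integrable)
  note lim = xi_partial_integrand_tendsto[OF ab, folded c_def, of k s x]
  obtain K where K: "integrable lborel K"
    "\<And>M p t. p \<ge> x + ln b \<Longrightarrow> norm (xi_partial_integrand k s c M p t) \<le> K t"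
    using xi_partial_integrand_dominated[OF s c q(1)] by blast
  have "(\<lambda>M. integral\<^sup>L lborel (xi_partial_integrand k s c M (x + ln b))) \<longlonglongrightarrow>
      (LINT t|lborel. indicator {0<..} t *\<^sub>R xi_integrand k s x a b t)"
    using K lim meas
    by (intro integral_dominated_convergence[where w = K] borel_measurable_LIMSEQ_metric[OF meas lim])
      auto
  then have "(\<lambda>M. 1 / Gamma s * (Gamma s * xi_partial_sum k s c M (x + ln b))) \<longlonglongrightarrow>
      arakawa_kaneko_xi k s x a b"
    using int unfolding arakawa_kaneko_xi_def set_lebesgue_integral_def
    by (intro tendsto_mult_left) (simp add: has_bochner_integral_iff)
  then show ?thesis using Gamma by (simp add: c_def)
qed

text \<open>The integral of the common majorant, divided by \<open>norm (Gamma s)\<close>, serves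
  for all \<open>M\<close> and \<open>p\<close>. It becomes the constant majorant for the
  integration over \<open>w\<close>.\<close>

lemma xi_partial_sum_bounded:
  fixes s :: complex and c q :: real and k :: int
  assumes s: "Re s > 0" and c: "c > 0"
    and q: "q > (if k \<ge> 1 then 0 else real_of_int \<bar>k\<bar> + 1) * c" "q > 0"
  obtains B where "\<And>M p. p \<ge> q \<Longrightarrow> norm (xi_partial_sum k s c M p) \<le> B"
proof -
  obtain K where K: "integrable lborel K"
    "\<And>M p t. p \<ge> q \<Longrightarrow> norm (xi_partial_integrand k s c M p t) \<le> K t"
    using xi_partial_integrand_dominated[OF s c q(1)] by blast
  have Gamma: "Gamma s \<noteq> 0"
    using s by (auto simp: Gamma_eq_zero_iff elim!: nonpos_Ints_cases)
  have "norm (xi_partial_sum k s c M p) \<le> integral\<^sup>L lborel K / norm (Gamma s)"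
    if p: "p \<ge> q" for M p
  proof -
    have int: "has_bochner_integral lborel (xi_partial_integrand k s c M p)
        (Gamma s * xi_partial_sum k s c M p)"
      using p q c s by (intro has_bochner_integral_xi_partial_integrand) auto
    have "norm (integral\<^sup>L lborel (xi_partial_integrand k s c M p)) \<le> integral\<^sup>L lborel K"
      using K p int by (intro Bochner_Integration.integral_norm_bound_integral)
        (auto simp: has_bochner_integral_iff)
    with int Gamma show ?thesis
      by (simp add: has_bochner_integral_iff norm_mult field_simps)
  qed
  then show thesis by (rule that)
qed

section \<open>Integration over the shift \<open>w\<close>\<close>

lemma continuous_on_xi_partial_sum:
  assumes "c \<ge> 0"
  shows "continuous_on {0<..} (xi_partial_sum k s c M)"
proof -
  have pos: "q + real i * c > 0" if "q > 0" for q i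
    using that assms by (intro add_pos_nonneg) auto
  have "continuous_on {0<..} (\<lambda>q. complex_of_real (q + real i * c) powr (- s))" for i
  proof (intro continuous_on_powr_complex continuous_intros)
    show "{0<..} \<subseteq> {q. Re (complex_of_real (q + real i * c)) \<ge> 0 \<or> Im (complex_of_real (q + real i * c)) \<noteq> 0}"
      using less_imp_le[OF pos[of _ i]] by auto
    \<comment> \<open>This condition concerns a vanishing base only; the base is positive, so it
      holds vacuously.\<close>
    show "Re (- s) > 0" if "q \<in> {0<..}" "complex_of_real (q + real i * c) = 0" for q
      using that pos[of q i] unfolding of_real_eq_0_iff by simp
  qed
  then show ?thesis
    unfolding xi_partial_sum_def
    by (intro continuous_on_sum continuous_on_mult continuous_on_const)
qed

text \<open>The fundamental theorem of calculus, with \<open>z powr (1 - s) / (1 - s)\<close> as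
  antiderivative of \<open>z powr (- s)\<close> off the branch cut.\<close>

lemma interval_integral_xi_partial_sum:
  fixes s :: complex and c p :: real
  assumes s: "s \<noteq> 1" and c: "c \<ge> 0" and p: "p > 0"
  shows "(LBINT w=0..ereal c. xi_partial_sum k s c M (p + w)) =
    1 / (s - 1) * (\<Sum>m<M. 1 / of_nat (m + 1) powi k *
      (\<Sum>j=0..m+1. of_nat ((m + 1) choose j) * (-1) ^ j * of_real (p + real j * c) powr (1 - s)))"
proof -
  define F where "F w = (\<Sum>m<M. 1 / of_nat (Suc m) powi k *
     (\<Sum>i\<le>m. of_nat (m choose i) * (-1) ^ i * (of_real (p + w + real i * c) powr (1 - s) / (1 - s))))"
    for w
  have pos: "p + w + real i * c > 0" if "w \<ge> 0" for w i
    using that c p by (intro add_pos_nonneg) auto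
  have "(LBINT w=ereal 0..ereal c. xi_partial_sum k s c M (p + w)) = F c - F 0"
  proof (rule interval_integral_FTC_finite)
    show "continuous_on {min 0 c..max 0 c} (\<lambda>w. xi_partial_sum k s c M (p + w))"
      using c p by (intro continuous_on_compose2[OF continuous_on_xi_partial_sum] continuous_intros) auto
    fix w assume w: "min 0 c \<le> w"
    have "((\<lambda>w. of_real (p + w + real i * c) powr (1 - s) / (1 - s)) has_vector_derivative
        of_real (p + w + real i * c) powr (- s)) (at w within {min 0 c..max 0 c})" for i
    proof -
      have *: "((\<lambda>z. z powr (1 - s) / (1 - s)) has_field_derivative z powr (- s)) (at z)"
        if "z \<notin> \<real>\<^sub>\<le>\<^sub>0" for z :: complex
        using that s by (auto intro!: derivative_eq_intros)
      have "((\<lambda>w. complex_of_real (p + w + real i * c)) has_vector_derivative 1) (at w within {min 0 c..max 0 c})"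
        by (auto intro!: derivative_eq_intros)
      moreover have "complex_of_real (p + w + real i * c) \<notin> \<real>\<^sub>\<le>\<^sub>0"
        using pos[of w i] w c by (simp del: of_real_add of_real_mult)
      ultimately show ?thesis
        using field_vector_diff_chain_within[OF _ has_field_derivative_at_within[OF *]]
        by (force simp: o_def)
    qed
    then show "(F has_vector_derivative xi_partial_sum k s c M (p + w)) (at w within {min 0 c..max 0 c})"
      unfolding F_def xi_partial_sum_def
      by (intro has_vector_derivative_sum has_vector_derivative_mult_right)
  qed
  also have "F c - F 0 = (\<Sum>m<M. 1 / of_nat (Suc m) powi k * (\<Sum>i\<le>m. of_nat (m choose i) * (-1) ^ i *
      ((of_real (p + c + real i * c) powr (1 - s) - of_real (p + real i * c) powr (1 - s)) / (1 - s))))"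
    by (simp only: F_def sum_subtractf[symmetric] right_diff_distrib[symmetric]
        diff_divide_distrib add_0_right)
  also have "\<dots> = 1 / (s - 1) * (\<Sum>m<M. 1 / of_nat (Suc m) powi k *
      (\<Sum>i\<le>m. of_nat (m choose i) * (-1) ^ i *
      (of_real (p + real i * c) powr (1 - s) - of_real (p + real (Suc i) * c) powr (1 - s))))"
  \<comment> \<open>The upper endpoint turns \<open>i\<close> into \<open>i + 1\<close>, because
    \<open>p + c + i * c = p + (i + 1) * c\<close>. Writing \<open>s - 1\<close> for
    \<open>1 - s\<close> reverses the difference, which fixes the sign as
    \<open>(-1) ^ j\<close>.\<close>
  proof -
    have "(complex_of_real (p + c + real i * c) powr (1 - s) - of_real (p + real i * c) powr (1 - s)) / (1 - s)
      = 1 / (s - 1) * (of_real (p + real i * c) powr (1 - s) - of_real (p + real (Suc i) * c) powr (1 - s))" for i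
      using s by (simp add: field_simps)
    then show ?thesis
      by (simp only: sum_distrib_left mult_ac)
  qed
  finally show ?thesis
    unfolding Suc_eq_plus1[symmetric] zero_ereal_def
    by (subst alternating_binomial_sum_Suc) simp
qed

text \<open>A second dominated convergence, now in \<open>w\<close> with a constant majorant on a
  bounded interval. The integrals of the truncations are exactly the partial sums on the right, so
  summability and value come out together.\<close>

theorem theorem4p5:
  fixes a b x :: real and k :: int and s :: complex
  assumes "a > 0" and "b > 0" and "a * b > 1"
    and "k \<ge> 1 \<Longrightarrow> x > 0"
    and "k \<le> 0 \<Longrightarrow> x > real_of_int \<bar>k\<bar> + 1"
    and "xi_converges k x a b"
    and "Re s > 0" and "s \<noteq> 1"
  shows "interval_lebesgue_integrable lborel 0 (ereal (ln (a * b)))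
           (\<lambda>w. arakawa_kaneko_xi k s (x + w) a b) \<and>
         summable (\<lambda>m. 1 / of_nat (m + 1) powi k *
           (\<Sum>j=0..m+1. of_nat ((m + 1) choose j) * (-1) ^ j *
              (1 / of_real (x + real j * ln a + real (j + 1) * ln b) powr (s - 1))) :: complex) \<and>
         (LBINT w=0..ereal (ln (a * b)). arakawa_kaneko_xi k s (x + w) a b) =
         1 / (s - 1) * (\<Sum>m. 1 / of_nat (m + 1) powi k *
           (\<Sum>j=0..m+1. of_nat ((m + 1) choose j) * (-1) ^ j *
              (1 / of_real (x + real j * ln a + real (j + 1) * ln b) powr (s - 1))))"
proof -
  define c where "c = ln (a * b)"
  define p where "p = x + ln b"
  define A :: "nat \<Rightarrow> complex" where "A m = 1 / of_nat (m + 1) powi k *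
      (\<Sum>j=0..m+1. of_nat ((m + 1) choose j) * (-1) ^ j *
        (1 / of_real (x + real j * ln a + real (j + 1) * ln b) powr (s - 1)))" for m
  define f where "f M w = indicator {0<..<c} w *\<^sub>R xi_partial_sum k s c M (p + w)" for M w
  define g where "g w = indicator {0<..<c} w *\<^sub>R arakawa_kaneko_xi k s (x + w) a b" for w
  have c: "c > 0" using assms(3) by (simp add: c_def)
  note p = xi_converges_bound[OF assms(6,3), folded c_def p_def]
  have ein: "einterval 0 (ereal c) = {0<..<c}"
    by (auto simp: einterval_def zero_ereal_def)
  have A_eq: "A m = 1 / of_nat (m + 1) powi k *
      (\<Sum>j=0..m+1. of_nat ((m + 1) choose j) * (-1) ^ j * of_real (p + real j * c) powr (1 - s))" for m
  proof -
    have "x + real j * ln a + real (j + 1) * ln b = p + real j * c" for j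
      using assms(1,2) by (simp add: p_def c_def ln_mult algebra_simps)
    moreover have "1 / z powr (s - 1) = z powr (1 - s)" for z :: complex
      using powr_minus[of z "s - 1"] by (simp add: field_simps)
    ultimately show ?thesis by (simp only: A_def)
  qed
  have f_meas: "f M \<in> borel_measurable lborel" for M
  proof -
    have "continuous_on {0<..<c} (\<lambda>w. xi_partial_sum k s c M (p + w))"
      using c p(2)
      by (intro continuous_on_compose2[OF continuous_on_xi_partial_sum] continuous_intros) auto
    from borel_measurable_continuous_on_indicator[OF _ this] show ?thesis
      unfolding f_def by simp
  qed
  have lim: "(\<lambda>M. f M w) \<longlonglongrightarrow> g w" for w
  proof (cases "w \<in> {0<..<c}")
    case True
    \<comment> \<open>The convergence condition is a lower bound on \<open>x\<close>, so it persists
      for \<open>w > 0\<close>.\<close>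
    then have "xi_converges k (x + w) a b"
      using assms(6) by (auto simp: xi_converges_def)
    from xi_partial_sum_tendsto[OF assms(1-3) this assms(7)] True show ?thesis
      by (simp add: f_def g_def c_def p_def add_ac)
  qed (simp add: f_def g_def)
  obtain B where B: "\<And>M q. q \<ge> p \<Longrightarrow> norm (xi_partial_sum k s c M q) \<le> B"
    using xi_partial_sum_bounded[OF assms(7) c p] by blast
  have dom: "norm (f M w) \<le> indicator {0<..<c} w * B" for M w
    using B[of "p + w" M] by (auto simp: f_def indicator_def)
  have dom_int: "integrable lborel (\<lambda>w. indicator {0<..<c} w * B)"
    using c by (intro integrable_mult_left) (simp add: integrable_indicator_iff)
  have g_meas: "g \<in> borel_measurable lborel"
    by (rule borel_measurable_LIMSEQ_metric[OF f_meas lim])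
  have "integrable lborel g"
    using dom dom_int lim f_meas g_meas
    by (intro integrable_dominated_convergence[where w = "\<lambda>w. indicator {0<..<c} w * B" and s = f]) auto
  then have integrable: "interval_lebesgue_integrable lborel 0 (ereal c)
      (\<lambda>w. arakawa_kaneko_xi k s (x + w) a b)"
    using c by (simp add: interval_lebesgue_integrable_def ein set_integrable_def g_def[abs_def])
  have "(\<lambda>M. integral\<^sup>L lborel (f M)) \<longlonglongrightarrow> integral\<^sup>L lborel g"
    using dom dom_int lim f_meas g_meas
    by (intro integral_dominated_convergence[where w = "\<lambda>w. indicator {0<..<c} w * B"]) auto
  moreover have "integral\<^sup>L lborel g = (LBINT w=0..ereal c. arakawa_kaneko_xi k s (x + w) a b)"
    using c by (simp add: interval_lebesgue_integral_le_eq ein set_lebesgue_integral_def g_def[abs_def])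
  moreover have "integral\<^sup>L lborel (f M) = 1 / (s - 1) * (\<Sum>m<M. A m)" for M
  proof -
    have "integral\<^sup>L lborel (f M) = (LBINT w=0..ereal c. xi_partial_sum k s c M (p + w))"
      using c by (simp add: interval_lebesgue_integral_le_eq ein set_lebesgue_integral_def f_def[abs_def])
    then show ?thesis
      unfolding A_eq using assms(8) c p(2) by (simp add: interval_integral_xi_partial_sum)
  qed
  ultimately have "(\<lambda>M. 1 / (s - 1) * (\<Sum>m<M. A m)) \<longlonglongrightarrow>
      (LBINT w=0..ereal c. arakawa_kaneko_xi k s (x + w) a b)"
    by simp
  \<comment> \<open>Undoing the factor \<open>1 / (s - 1)\<close> leaves the bare partial sums,
    whose convergence is the definition of \<open>sums\<close>.\<close>
  from tendsto_mult_left[OF this, of "s - 1"] assms(8)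
  have sums: "A sums ((s - 1) * (LBINT w=0..ereal c. arakawa_kaneko_xi k s (x + w) a b))"
    by (simp add: sums_def)
  then have "(LBINT w=0..ereal c. arakawa_kaneko_xi k s (x + w) a b) = 1 / (s - 1) * suminf A"
    using assms(8) by (simp add: sums_iff)
  with integrable sums_summable[OF sums] show ?thesis
    unfolding A_def c_def by blast
qed

end
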